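(* Let $T>0$, $L>0$, $0<\alpha<1$, $\lambda>-1/2$, let $N$ be a positive even integer and $N_G$ a positive integer. Then the $\alpha$th-order Fourier-Gegenbauer-based pseudospectral fractional integration matrix with index $L$ (FGPSFIM), i.e. the $N\times N$ matrix $${}_{L}^{E}\boldsymbol{\mathcal{Q}}^{\alpha}_{N_G}=\left({}_{L}^{E}\mathcal{Q}^{\alpha}_{N_G,l,j}\right)_{0\le l,j\le N-1},\qquad {}_{L}^{E}\mathcal{Q}^{\alpha}_{N_G,l,j}=\frac12\sum_{k=0}^{N_G}P_k\,\mathcal{F}_j'\!\left(t_{N,l}-L\,\left(\hat z_{N_G,k}^{\lambda}\right)^{\frac{1}{1-\alpha}}\right),$$ is a Toeplitz matrix.
   Context: Equally spaced nodes: $t_{N,j}=Tj/N$ for $j=0,\dots,N-1$. Trigonometric Lagrange polynomials: with $\omega_k=2\pi k/T$, for $j=0,\dots,N-1$, $$\mathcal{F}_j(t)=\frac1N\sum_{k=-N/2}^{N/2-1}e^{i\omega_k(t-t_{N,j})}$$ when complex-valued functions are interpolated, and $$\mathcal{F}_j(t)=\frac1N\sum_{k=-N/2}^{N/2-1}\cos\left(\omega_k(t-t_{N,j})\right)$$ when real-valued functions are interpolated; $\mathcal{F}_j'$ is the derivative of $\mathcal{F}_j$ with respect to its argument. (The statement is meant for either form, the same form being used for all $j$.) Gegenbauer-Gauss (GG) points: $z_{N_G,0}^{\lambda},\dots,z_{N_G,N_G}^{\lambda}\in(-1,1)$ are the zeros of the $(N_G+1)$st-degree Gegenbauer polynomial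 with index $\lambda$ (orthogonal on $[-1,1]$ with weight $(1-x^2)^{\lambda-1/2}$). The shifted points are $\hat z_{N_G,k}^{\lambda}=\frac12(z_{N_G,k}^{\lambda}+1)\in(0,1)$. Integration row vector: $\mathbf{P}=(P_0,\dots,P_{N_G})$ is the GG-points-based integration row vector, $P_k=\int_{-1}^1\ell_k(x)\,dx$, where $\ell_k$ is the Lagrange basis polynomial of degree $N_G$ at the GG points, so that $\sum_kP_kh(z_{N_G,k}^{\lambda})$ is the interpolatory quadrature for $\int_{-1}^1h(x)\,dx$. A Toeplitz matrix is a matrix $(a_{l,j})$ with $a_{l+1,j+1}=a_{l,j}$ for all admissible $l,j$. *)

theory Defs
  imports "HOL-Analysis.Analysis" "HOL-Computational_Algebra.Polynomial" "Jordan_Normal_Form.Matrix"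
begin

text \<open>A Gegenbauer polynomial of degree \<open>n\<close> and index \<open>lam\<close>, determined by orthogonality up to a
  nonzero constant factor. No normalisation is fixed, since only the zeros are used.\<close>

definition gegenbauer_poly :: "real \<Rightarrow> nat \<Rightarrow> real poly \<Rightarrow> bool" where
  "gegenbauer_poly lam n p \<longleftrightarrow>
     p \<noteq> 0 \<and> degree p = n \<and>
     (\<forall>q. degree q < n \<longrightarrow>
        ((\<lambda>x. poly p x * poly q x * (1 - x\<^sup>2) powr (lam - 1/2)) has_integral 0) {-1..1})"

text \<open>\<open>z 0, \<dots>, z NG\<close> enumerate, without repetition and in any order, the zeros of the Gegenbauer
  polynomial of degree \<open>NG + 1\<close>. For \<open>lam > -1/2\<close> these zeros are real, simple and lie
  in \<open>(-1, 1)\<close>, so such an enumeration exists.\<close>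

definition gegenbauer_gauss_points :: "real \<Rightarrow> nat \<Rightarrow> (nat \<Rightarrow> real) \<Rightarrow> bool" where
  "gegenbauer_gauss_points lam NG z \<longleftrightarrow>
     (\<exists>p. gegenbauer_poly lam (NG + 1) p \<and> bij_betw z {0..NG} {x. poly p x = 0})"

definition shifted_point :: "(nat \<Rightarrow> real) \<Rightarrow> nat \<Rightarrow> real" where
  "shifted_point z k = (z k + 1) / 2"

definition lagrange_basis :: "nat \<Rightarrow> (nat \<Rightarrow> real) \<Rightarrow> nat \<Rightarrow> real \<Rightarrow> real" where
  "lagrange_basis NG z k x = (\<Prod>m\<in>{0..NG} - {k}. (x - z m) / (z k - z m))"

definition integration_weight :: "nat \<Rightarrow> (nat \<Rightarrow> real) \<Rightarrow> nat \<Rightarrow> real" where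
  "integration_weight NG z k = integral {-1..1} (lagrange_basis NG z k)"

definition node :: "real \<Rightarrow> nat \<Rightarrow> nat \<Rightarrow> real" where
  "node T N j = T * real j / real N"

definition freq :: "real \<Rightarrow> int \<Rightarrow> real" where
  "freq T k = 2 * pi * of_int k / T"

definition trig_lagrange_complex :: "real \<Rightarrow> nat \<Rightarrow> nat \<Rightarrow> real \<Rightarrow> complex" where
  "trig_lagrange_complex T N j t =
     1 / of_nat N * (\<Sum>k\<in>{- (int N div 2)..int N div 2 - 1}.
        exp (\<i> * complex_of_real (freq T k * (t - node T N j))))"

definition trig_lagrange_real :: "real \<Rightarrow> nat \<Rightarrow> nat \<Rightarrow> real \<Rightarrow> real" where
  "trig_lagrange_real T N j t =
     1 / of_nat N * (\<Sum>k\<in>{- (int N div 2)..int N div 2 - 1}. cos (freq T k * (t - node T N j)))"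

text \<open>The family \<open>F\<close> of trigonometric Lagrange polynomials is a parameter, so that one definition
  serves both the complex and the real form.\<close>

definition FGPSFIM ::
  "(nat \<Rightarrow> real \<Rightarrow> 'a::real_normed_vector) \<Rightarrow> real \<Rightarrow> real \<Rightarrow> real \<Rightarrow> nat \<Rightarrow> nat \<Rightarrow> (nat \<Rightarrow> real) \<Rightarrow> 'a mat" where
  "FGPSFIM F T L \<alpha> N NG z =
     Matrix.mat N N (\<lambda>(l, j). (1/2) *\<^sub>R (\<Sum>k=0..NG. integration_weight NG z k *\<^sub>R
        vector_derivative (F j)
          (at (node T N l - L * shifted_point z k powr (1 / (1 - \<alpha>))))))"

definition toeplitz :: "'a mat \<Rightarrow> bool" where
  "toeplitz A \<longleftrightarrow>
     (\<forall>l j. l + 1 < dim_row A \<longrightarrow> j + 1 < dim_col A \<longrightarrow> A $$ (l + 1, j + 1) = A $$ (l, j))"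

end

theory Submission imports Defs begin

text \<open>All \<open>F j\<close> are translates \<open>G (t - node T N j)\<close> of one function \<open>G\<close>, so the entry \<open>(l, j)\<close>
  depends on \<open>l\<close> and \<open>j\<close> only through \<open>node T N l - node T N j\<close>, hence only through \<open>l - j\<close>
  because the nodes are equally spaced.\<close>

lemma has_vector_derivative_translate:
  fixes f :: "real \<Rightarrow> 'a::real_normed_vector"
  assumes "(f has_vector_derivative D) (at (x - a))"
  shows "((\<lambda>t. f (t - a)) has_vector_derivative D) (at x)"
proof -
  have "((\<lambda>t. t - a) has_vector_derivative 1) (at x)"
    by (auto intro!: derivative_eq_intros)
  from vector_diff_chain_at[OF this assms] show ?thesis
    by (simp add: o_def)
qed

text \<open>\<open>vector_derivative\<close> is a choice among all \<open>D\<close> satisfying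
  \<open>has_vector_derivative\<close>. Both sides choose from the same set, so they agree even
  where \<open>f\<close> is not differentiable.\<close>

lemma vector_derivative_translate:
  fixes f :: "real \<Rightarrow> 'a::real_normed_vector"
  shows "vector_derivative (\<lambda>t. f (t - a)) (at x) = vector_derivative f (at (x - a))"
proof -
  have "((\<lambda>t. f (t - a)) has_vector_derivative D) (at x) \<longleftrightarrow>
      (f has_vector_derivative D) (at (x - a))" for D
    \<comment> \<open>The second instance translates back by \<open>- a\<close>, which gives the
      converse.\<close>
    using has_vector_derivative_translate[of f D x a]
      has_vector_derivative_translate[of "\<lambda>t. f (t - a)" D "x - a" "- a"] by auto
  then show ?thesis
    by (simp add: vector_derivative_def)
qed

text \<open>Both nodes move by \<open>T / N\<close>, which cancels. Here \<open>c\<close> stands for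
  the shift \<open>L * shifted_point z k powr (1 / (1 - \<alpha>))\<close>, the same in every
  entry.\<close>

lemma node_diff_Suc: "node T N (Suc l) - c - node T N (Suc j) = node T N l - c - node T N j"
  by (simp add: node_def algebra_simps add_divide_distrib)

lemma toeplitz_FGPSFIM_translates:
  assumes F: "\<And>j. F j = (\<lambda>t. G (t - node T N j))"
  shows "toeplitz (FGPSFIM F T L \<alpha> N NG z)"
  by (simp add: toeplitz_def FGPSFIM_def F vector_derivative_translate node_diff_Suc)

theorem theorem4p1:
  fixes T L \<alpha> lam :: real and N NG :: nat and z :: "nat \<Rightarrow> real"
  assumes "T > 0" and "L > 0" and "0 < \<alpha>" and "\<alpha> < 1" and "lam > -1/2"
    and "N > 0" and "even N" and "NG > 0"
    and "gegenbauer_gauss_points lam NG z"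
  shows "toeplitz (FGPSFIM (trig_lagrange_complex T N) T L \<alpha> N NG z)
       \<and> toeplitz (FGPSFIM (trig_lagrange_real T N) T L \<alpha> N NG z)"
proof
  show "toeplitz (FGPSFIM (trig_lagrange_complex T N) T L \<alpha> N NG z)"
    \<comment> \<open>\<open>G\<close> is the defining sum with \<open>s\<close> in place of
      \<open>t - node T N j\<close>, so it is free of \<open>j\<close>.\<close>
    by (rule toeplitz_FGPSFIM_translates[where G = "\<lambda>s. 1 / of_nat N *
          (\<Sum>k\<in>{- (int N div 2)..int N div 2 - 1}. exp (\<i> * complex_of_real (freq T k * s)))"])
      (rule ext, rule trig_lagrange_complex_def)
  show "toeplitz (FGPSFIM (trig_lagrange_real T N) T L \<alpha> N NG z)"
    by (rule toeplitz_FGPSFIM_translates[where G = "\<lambda>s. 1 / of_nat N *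
          (\<Sum>k\<in>{- (int N div 2)..int N div 2 - 1}. cos (freq T k * s))"])
      (rule ext, rule trig_lagrange_real_def)
qed

end
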